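(* For all integers $n\ge 1$ and all integers $r$, $$h(n,0,r)=h(n,0,-r),$$ where $h(n,0,r)$ denotes the number of partitions $\lambda$ of $n$ that are not Rogers-Ramanujan partitions and whose $(2,0)$-rank $r_{2,0}(\lambda)$ equals $r$.
   Context: A partition $\lambda$ of $n$ is a finite sequence $\lambda_1\ge\dots\ge\lambda_{\ell(\lambda)}>0$ of integers with sum $n$; put $\lambda_j=0$ for $j>\ell(\lambda)$. Its Young diagram $[\lambda]$ has rows of lengths $\lambda_1,\lambda_2,\dots$ from top to bottom. The conjugate partition is denoted $\lambda'$. A (nonempty) partition $\lambda$ is a Rogers-Ramanujan partition if its smallest part $e(\lambda)=\lambda_{\ell(\lambda)}$ satisfies $e(\lambda)\ge\ell(\lambda)$. For a partition $\lambda$ that is not a Rogers-Ramanujan partition, the first Durfee square is the largest square which fits in the top left corner of $[\lambda]$, of side $s=s_0(\lambda)\ge 1$ (so $s$ is the largest integer with $\lambda_s\ge s$), and the second Durfee square is the largest square which fits (left-justified) in $[\lambda]$ directly below the first, of side $t=t_0(\lambda)\ge 1$ (so $t$ is the largest integer with $\lambda_{s+t}\ge t$). Both exist exactly because $\lambda$ is not Rogers-Ramanujan. Let $\alpha,\beta,\gamma$ be the partitions to the right of the first square, to the right of the second square, and below the second square: $\alpha_i=\lambda_i-s$ for $1\le i\le s$, $\beta_i=\lambda_{s+i}-t$ for $1\le i\le t$, $\gamma_i=\lambda_{s+t+i}$ for $i\ge1$ (parts outside these ranges are $0$). The $(2,0)$-rank is $$r_{2,0}(\lambda)=\beta_1+\alpha_{s-t-\beta_1+1}-\gamma_1',$$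 where $\gamma_1'$ is the number of (nonzero) parts of $\gamma$. *)

theory Defs
  imports Main
begin

definition is_partition :: "nat list \<Rightarrow> nat \<Rightarrow> bool" where
  "is_partition xs n \<longleftrightarrow> sorted_wrt (\<ge>) xs \<and> (\<forall>x \<in> set xs. x > 0) \<and> sum_list xs = n"

text \<open>Parts are indexed from 1 and are 0 beyond the last part; index 0 is a dummy with value 0.
  The partitions to the right of and below the Durfee squares are represented by such
  1-indexed part functions.\<close>

definition part :: "nat list \<Rightarrow> nat \<Rightarrow> nat" where
  "part xs j = (if 1 \<le> j \<and> j \<le> length xs then xs ! (j - 1) else 0)"

definition conj_part :: "(nat \<Rightarrow> nat) \<Rightarrow> nat \<Rightarrow> nat" where
  "conj_part f j = card {i. i \<ge> 1 \<and> f i \<ge> j}"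

definition rogers_ramanujan :: "nat list \<Rightarrow> bool" where
  "rogers_ramanujan xs \<longleftrightarrow> xs \<noteq> [] \<and> last xs \<ge> length xs"

text \<open>Both sets of side lengths below contain 0 and are bounded by the number of parts, so the
  greatest elements exist; for a nonempty partition that is not Rogers-Ramanujan both are
  at least 1.\<close>

definition durfee1 :: "nat list \<Rightarrow> nat" where
  "durfee1 xs = (GREATEST s. part xs s \<ge> s)"

definition durfee2 :: "nat list \<Rightarrow> nat" where
  "durfee2 xs = (GREATEST t. part xs (durfee1 xs + t) \<ge> t)"

definition alpha_part :: "nat list \<Rightarrow> nat \<Rightarrow> nat" where
  "alpha_part xs i =
     (if 1 \<le> i \<and> i \<le> durfee1 xs then part xs i - durfee1 xs else 0)"

definition beta_part :: "nat list \<Rightarrow> nat \<Rightarrow> nat" where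
  "beta_part xs i =
     (if 1 \<le> i \<and> i \<le> durfee2 xs then part xs (durfee1 xs + i) - durfee2 xs else 0)"

definition gamma_part :: "nat list \<Rightarrow> nat \<Rightarrow> nat" where
  "gamma_part xs i = (if i \<ge> 1 then part xs (durfee1 xs + durfee2 xs + i) else 0)"

text \<open>The natural-number subtractions do not truncate: \<open>xs\<close> is weakly decreasing, and for
  \<open>s = durfee1 xs\<close>, \<open>t = durfee2 xs \<ge> 1\<close> one has
  \<open>t + beta_part xs 1 = part xs (s + 1) \<le> s\<close> by maximality of \<open>s\<close>.\<close>

definition rank20 :: "nat list \<Rightarrow> int" where
  "rank20 xs =
     int (beta_part xs 1)
     + int (alpha_part xs (durfee1 xs - durfee2 xs - beta_part xs 1 + 1))
     - int (conj_part (gamma_part xs) 1)"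

definition h0 :: "nat \<Rightarrow> int \<Rightarrow> nat" where
  "h0 n r = card {xs. is_partition xs n \<and> \<not> rogers_ramanujan xs \<and> rank20 xs = r}"

end

(*
  Following Boulet and Pak: for 1 <= t <= s the pairs consisting of a partition alpha with at most
  s parts and a partition beta in a t by (s - t) box correspond, preserving the total size, to the
  pairs of a partition mu with at most t parts and a partition nu with at most s - t parts. Here
  mu_i = beta_i + alpha_{k_i} with k_i = s - t - beta_i + i, and nu consists of the remaining parts
  of alpha. Then r_{2,0} = mu_1 - delta_1 where delta is the conjugate of gamma. As gamma has parts
  of size at most t, delta has at most t parts as well, so exchanging mu and delta preserves n and
  negates the rank.
*)
theory Submission
  imports Defs
begin

abbreviation desc :: "nat list \<Rightarrow> bool" where
  "desc \<equiv> sorted_wrt (\<ge>)"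

section \<open>Trading alpha and beta for mu and nu\<close>

text \<open>Partitions with a bounded number of parts are weakly decreasing lists of fixed length, padded
  with zeros. A part \<open>m\<close> of mu that ends up in front of exactly \<open>k\<close> parts of nu is split
  into the part \<open>m - k\<close> of alpha and the part \<open>k\<close> of beta; the comparison is the only one that
  keeps alpha decreasing.\<close>
fun join :: "nat list \<Rightarrow> nat list \<Rightarrow> nat list \<times> nat list" where
  "join [] ns = (ns, [])"
| "join (m # ms) [] = (case join ms [] of (as, bs) \<Rightarrow> (m # as, 0 # bs))"
| "join (m # ms) (n # ns) =
     (if n + Suc (length ns) \<le> m
      then case join ms (n # ns) of (as, bs) \<Rightarrow>
        ((m - Suc (length ns)) # as, Suc (length ns) # bs)
      else case join (m # ms) ns of (as, bs) \<Rightarrow> (n # as, bs))"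

text \<open>The second equation is a junk value: the length of \<open>as\<close> is at least that of \<open>bs\<close>
  whenever this function is used.\<close>
fun unjoin :: "nat list \<Rightarrow> nat list \<Rightarrow> nat list \<times> nat list" where
  "unjoin as [] = ([], as)"
| "unjoin [] (b # bs) = ([], [])"
| "unjoin (a # as) (b # bs) =
     (if b = length as - length bs
      then case unjoin as bs of (ms, ns) \<Rightarrow> ((a + b) # ms, ns)
      else case unjoin as (b # bs) of (ms, ns) \<Rightarrow> (ms, a # ns))"

lemma length_join:
  assumes "join ms ns = (as, bs)"
  shows "length as = length ms + length ns" "length bs = length ms"
proof -
  have "length (fst (join ms ns)) = length ms + length ns \<and>
    length (snd (join ms ns)) = length ms"
    by (induction ms ns rule: join.induct) (simp_all add: split_beta)
  with assms show "length as = length ms + length ns" "length bs = length ms"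
    by simp_all
qed

lemma sum_list_join:
  "join ms ns = (as, bs) \<Longrightarrow> sum_list as + sum_list bs = sum_list ms + sum_list ns"
  by (induction ms ns arbitrary: as bs rule: join.induct)
    (fastforce split: prod.splits if_splits)+

lemma snd_join_le:
  "join ms ns = (as, bs) \<Longrightarrow> b \<in> set bs \<Longrightarrow> b \<le> length ns"
  by (induction ms ns arbitrary: as bs rule: join.induct)
    (fastforce split: prod.splits if_splits)+

text \<open>A part of mu loses as many units as there are parts of nu still to be placed, so
  \<open>ms\<close> is allowed the slack \<open>length ns\<close>. Placing a part of nu shrinks this
  slack by one, which the failed comparison pays for.\<close>

lemma fst_join_le:
  assumes "join ms ns = (as, bs)" "desc ms" "\<forall>y\<in>set ns. y \<le> x"
    "\<forall>y\<in>set ms. y \<le> x + length ns" "a \<in> set as"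
  shows "a \<le> x"
  using assms
proof (induction ms ns arbitrary: as bs rule: join.induct)
  case (3 m ms n ns)
  show ?case
  proof (cases "n + Suc (length ns) \<le> m")
    case True
    with 3 show ?thesis by (auto split: prod.splits)
  next
    case False
    obtain as' bs' where j: "join (m # ms) ns = (as', bs')" by fastforce
    \<comment> \<open>The failed comparison gives \<open>m \<le> n + length ns\<close>, and
      \<open>n \<le> x\<close>.\<close>
    have "m \<le> x + length ns" using 3(5) False by simp
    then have "\<forall>y\<in>set (m # ms). y \<le> x + length ns"
      using 3(4) by fastforce
    with False 3 j show ?thesis by (auto split: prod.splits)
  qed
qed (auto split: prod.splits)

text \<open>Beta decreases because its parts count the parts of nu that remain. Alpha decreases by
  \<open>fst_join_le\<close>, with \<open>x\<close> the part of alpha just placed.\<close>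

lemma desc_join:
  assumes "join ms ns = (as, bs)" "desc ms" "desc ns"
  shows "desc as \<and> desc bs"
  using assms
proof (induction ms ns arbitrary: as bs rule: join.induct)
  case (2 m ms)
  obtain as' bs' where j: "join ms [] = (as', bs')" by fastforce
  with 2 fst_join_le[OF j, of m] snd_join_le[OF j] show ?case by auto
next
  case (3 m ms n ns)
  show ?case
  proof (cases "n + Suc (length ns) \<le> m")
    case True
    obtain as' bs' where j: "join ms (n # ns) = (as', bs')" by fastforce
    have "a \<le> m - Suc (length ns)" if "a \<in> set as'" for a
      using 3(4,5) True by (intro fst_join_le[OF j _ _ _ that]) auto
    with 3 True j snd_join_le[OF j] show ?thesis by auto
  next
    case False
    obtain as' bs' where j: "join (m # ms) ns = (as', bs')" by fastforce
    have "a \<le> n" if "a \<in> set as'" for a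
      using 3(4,5) False by (intro fst_join_le[OF j _ _ _ that]) fastforce+
    with 3 False j show ?thesis by auto
  qed
qed auto

text \<open>In \<open>unjoin\<close>, \<open>length as - length bs\<close> counts the parts of nu
  not yet recovered, so the head of alpha comes from mu exactly when the head of beta equals this
  count.\<close>

lemma unjoin_join:
  assumes "join ms ns = (as, bs)"
  shows "unjoin as bs = (ms, ns)"
  using assms
proof (induction ms ns arbitrary: as bs rule: join.induct)
  case (2 m ms)
  obtain as' bs' where j: "join ms [] = (as', bs')" by fastforce
  with 2 length_join[OF j] show ?case by auto
next
  case (3 m ms n ns)
  show ?case
  proof (cases "n + Suc (length ns) \<le> m")
    case True
    obtain as' bs' where j: "join ms (n # ns) = (as', bs')" by fastforce
    with 3 True length_join[OF j] show ?thesis by auto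
  next
    case False
    obtain as' bs' where j: "join (m # ms) ns = (as', bs')" by fastforce
    then obtain b bs'' where b: "bs' = b # bs''"
      using length_join[OF j] by (cases bs') auto
    \<comment> \<open>Here \<open>b \<le> length ns\<close>, whereas a match in
      \<open>unjoin\<close> would need \<open>b = Suc (length ns)\<close>.\<close>
    with 3 False j length_join[OF j] snd_join_le[OF j, of b] show ?thesis by auto
  qed
qed auto

text \<open>Explains the entry of alpha in the rank: the first part of mu has \<open>hd bs\<close>
  parts of nu behind it, hence \<open>length ns - hd bs\<close> in front, which is its 0-based
  position in alpha.\<close>

lemma hd_join:
  assumes "join ms ns = (as, bs)" "ms \<noteq> []"
  shows "hd ms = hd bs + as ! (length ns - hd bs)"
  using assms
proof (induction ms ns arbitrary: as bs rule: join.induct)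
  case (3 m ms n ns)
  show ?case
  proof (cases "n + Suc (length ns) \<le> m")
    case True
    with 3 show ?thesis by (auto split: prod.splits)
  next
    case False
    obtain as' bs' where j: "join (m # ms) ns = (as', bs')" by fastforce
    then have "bs' \<noteq> []" using length_join[OF j] by auto
    then have "hd bs' \<le> length ns" using snd_join_le[OF j] by auto
    with 3 False j show ?thesis by (auto simp: Suc_diff_le)
  qed
qed (auto split: prod.splits)

text \<open>The box condition guarantees that every part of beta finds its match: the gap between
  the lengths starts at or above \<open>b\<close> and drops by one with each part given to nu, so it
  reaches \<open>b\<close> in time.\<close>

lemma length_unjoin:
  assumes "unjoin as bs = (ms, ns)" "desc bs" "length bs \<le> length as"
    "\<forall>b\<in>set bs. b \<le> length as - length bs"
  shows "length ms = length bs \<and> length ns = length as - length bs"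
  using assms
proof (induction as bs arbitrary: ms ns rule: unjoin.induct)
  case (3 a as b bs)
  show ?case
  proof (cases "b = length as - length bs")
    case True
    obtain ms' ns' where j: "unjoin as bs = (ms', ns')" by fastforce
    have "length ms' = length bs \<and> length ns' = length as - length bs"
      using 3(4-6) by (intro 3(1)[OF True j]) auto
    with 3(3) True j show ?thesis by auto
  next
    case False
    then have b: "b < length as - length bs" using 3(6) by auto
    obtain ms' ns' where j: "unjoin as (b # bs) = (ms', ns')" by fastforce
    have "\<forall>b'\<in>set (b # bs). b' \<le> length as - length (b # bs)"
      using 3(4) b by fastforce
    then have "length ms' = length (b # bs) \<and> length ns' = length as - length (b # bs)"
      using 3(4) b by (intro 3(2)[OF False j]) auto
    with 3(3) False j b show ?thesis by auto
  qed
qed auto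

text \<open>Used with \<open>x\<close> and \<open>c\<close> the heads of alpha and beta, to compare
  the next part of mu or nu with all later ones.\<close>

lemma unjoin_le:
  assumes "unjoin as bs = (ms, ns)" "\<forall>a\<in>set as. a \<le> x" "\<forall>b\<in>set bs. b \<le> c"
  shows "(\<forall>y\<in>set ms. y \<le> x + c) \<and> (\<forall>y\<in>set ns. y \<le> x)"
  using assms
proof (induction as bs arbitrary: ms ns rule: unjoin.induct)
  case (1 as)
  then show ?case by simp
next
  case (2 b bs)
  then show ?case by simp
next
  case (3 a as b bs)
  show ?case
  proof (cases "b = length as - length bs")
    case True
    obtain ms' ns' where j: "unjoin as bs = (ms', ns')" by fastforce
    have "(\<forall>y\<in>set ms'. y \<le> x + c) \<and> (\<forall>y\<in>set ns'. y \<le> x)"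
      using 3(4,5) by (intro 3(1)[OF True j]) auto
    moreover have "a + b \<le> x + c" using 3(4,5) by (simp add: add_mono)
    moreover have "ms = (a + b) # ms'" "ns = ns'" using 3(3) True j by simp_all
    ultimately show ?thesis by simp
  next
    case False
    obtain ms' ns' where j: "unjoin as (b # bs) = (ms', ns')" by fastforce
    have "(\<forall>y\<in>set ms'. y \<le> x + c) \<and> (\<forall>y\<in>set ns'. y \<le> x)"
      using 3(4,5) by (intro 3(2)[OF False j]) auto
    moreover have "ms = ms'" "ns = a # ns'" using 3(3) False j by simp_all
    ultimately show ?thesis using 3(4) by simp
  qed
qed

text \<open>The comparison in \<open>join\<close> repeats the decision of \<open>unjoin\<close>, by
  the bounds of \<open>unjoin_le\<close> and the count of \<open>length_unjoin\<close>.\<close>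

lemma join_unjoin:
  assumes "unjoin as bs = (ms, ns)" "desc as" "desc bs" "length bs \<le> length as"
    "\<forall>b\<in>set bs. b \<le> length as - length bs"
  shows "desc ms \<and> desc ns \<and> join ms ns = (as, bs)"
  using assms
proof (induction as bs arbitrary: ms ns rule: unjoin.induct)
  case (1 as)
  then show ?case by simp
next
  case (2 b bs)
  then show ?case by simp
next
  case (3 a as b bs)
  show ?case
  proof (cases "b = length as - length bs")
    case True
    obtain ms' ns' where j: "unjoin as bs = (ms', ns')" by fastforce
    have bnd: "\<forall>b\<in>set bs. b \<le> length as - length bs" using 3(7) by simp
    have IH: "desc ms' \<and> desc ns' \<and> join ms' ns' = (as, bs)"
      using 3(4-7) by (intro 3(1)[OF True j]) auto
    have le: "(\<forall>y\<in>set ms'. y \<le> a + b) \<and> (\<forall>y\<in>set ns'. y \<le> a)"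
      using 3(4,5) by (intro unjoin_le[OF j]) auto
    have len: "length ns' = b"
      using length_unjoin[OF j _ _ bnd] 3(5,6) True by simp
    have eq: "ms = (a + b) # ms'" "ns = ns'" using 3(3) True j by simp_all
    \<comment> \<open>The head of \<open>ns'\<close>, if any, is at most \<open>a\<close>, and
      \<open>length ns' = b\<close>, so \<open>a + b\<close> passes the comparison. If
      \<open>ns'\<close> is empty, then \<open>b = 0\<close>.\<close>
    have "join ms ns = (a # as, b # bs)"
      using IH len le by (cases ns') (auto simp: eq)
    with IH le eq show ?thesis by simp
  next
    case False
    then have b: "b < length as - length bs" using 3(7) by auto
    obtain ms' ns' where j: "unjoin as (b # bs) = (ms', ns')" by fastforce
    have bnd: "\<forall>b'\<in>set (b # bs). b' \<le> length as - length (b # bs)"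
      using 3(5) b by fastforce
    have IH: "desc ms' \<and> desc ns' \<and> join ms' ns' = (as, b # bs)"
      using 3(4,5) b bnd by (intro 3(2)[OF False j]) auto
    have le: "(\<forall>y\<in>set ms'. y \<le> a + b) \<and> (\<forall>y\<in>set ns'. y \<le> a)"
      using 3(4,5) by (intro unjoin_le[OF j]) auto
    have len: "length ms' = Suc (length bs)" "length ns' = length as - Suc (length bs)"
      using length_unjoin[OF j 3(5) _ bnd] b by auto
    have eq: "ms = ms'" "ns = a # ns'" using 3(3) False j by simp_all
    obtain m ms'' where m: "ms' = m # ms''" using len by (cases ms') auto
    \<comment> \<open>Since \<open>b \<le> length ns'\<close>, the bound
      \<open>m \<le> a + b\<close> makes the comparison fail.\<close>
    have "\<not> a + Suc (length ns') \<le> m" using le m len b by auto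
    then have "join ms ns = (a # as, b # bs)" using IH m eq by simp
    with IH le eq show ?thesis by simp
  qed
qed

section \<open>Conjugation\<close>

text \<open>Prepends a first column of height \<open>d\<close> to the diagram whose remaining columns are
  \<open>ds\<close>. The argument may contain zeros, the result does not.\<close>
fun conjugate :: "nat list \<Rightarrow> nat list" where
  "conjugate [] = []"
| "conjugate (d # ds) = map Suc (conjugate ds @ replicate (d - length (conjugate ds)) 0)"

text \<open>Reads off a prescribed number of columns, empty ones included, because delta is a list
  of fixed length padded with zeros.\<close>

fun unconjugate :: "nat \<Rightarrow> nat list \<Rightarrow> nat list" where
  "unconjugate 0 gs = []"
| "unconjugate (Suc t) gs = length gs # unconjugate t (filter ((<) 0) (map (\<lambda>g. g - 1) gs))"

lemma length_conjugate: "desc ds \<Longrightarrow> length (conjugate ds) = (if ds = [] then 0 else hd ds)"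
  by (induction ds) (auto simp: neq_Nil_conv)

text \<open>Ensures that the subtraction in \<open>conjugate\<close> does not truncate, so the new
  first column has height exactly \<open>d\<close>.\<close>

lemma length_conjugate_le: "desc (d # ds) \<Longrightarrow> length (conjugate ds) \<le> d"
  by (cases ds) (auto simp: length_conjugate simp del: conjugate.simps)

lemma set_conjugate: "g \<in> set (conjugate ds) \<Longrightarrow> 0 < g \<and> g \<le> length ds"
  by (induction ds arbitrary: g) auto

lemma desc_replicate: "desc (replicate n x)"
  by (induction n) auto

lemma desc_conjugate: "desc (conjugate ds)"
proof (induction ds)
  case (Cons d ds)
  then show ?case
    by (simp only: conjugate.simps sorted_wrt_map)
      (simp add: sorted_wrt_append desc_replicate)
qed simp

lemma sum_list_map_Suc: "sum_list (map Suc xs) = length xs + sum_list xs"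
  by (induction xs) auto

lemma sum_list_conjugate: "desc ds \<Longrightarrow> sum_list (conjugate ds) = sum_list ds"
proof (induction ds)
  case (Cons d ds)
  then show ?case
    using length_conjugate_le[OF Cons.prems]
    by (simp only: conjugate.simps sum_list_map_Suc) (simp add: sum_list_replicate)
qed simp

lemma unconjugate_conjugate: "desc ds \<Longrightarrow> unconjugate (length ds) (conjugate ds) = ds"
proof (induction ds)
  case (Cons d ds)
  have "filter ((<) 0) (conjugate ds) = conjugate ds"
    using set_conjugate by (auto simp: filter_id_conv)
  then show ?case
    using Cons length_conjugate_le[OF Cons.prems] by (simp add: comp_def)
qed simp

lemma filter_pos_append_zeros:
  "desc xs \<Longrightarrow>
    filter ((<) 0) xs @ replicate (length xs - length (filter ((<) 0) xs)) 0 = xs"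
proof (induction xs)
  case (Cons x xs)
  show ?case
  proof (cases "x = 0")
    case True
    with Cons.prems have "\<forall>y\<in>set xs. y = 0" by simp
    then have "filter ((<) 0) xs = []" "replicate (length xs) 0 = xs"
      by (auto simp: filter_empty_conv replicate_length_same)
    with True show ?thesis by simp
  next
    case False
    with Cons show ?thesis by simp
  qed
qed simp

text \<open>Removing the first column turns some parts into zeros. These form a tail of the
  decreasing list, so \<open>conjugate\<close> restores exactly them. The bound \<open>t\<close>
  ensures that \<open>t\<close> columns exhaust the diagram.\<close>

lemma conjugate_unconjugate:
  assumes "desc gs" "\<forall>g\<in>set gs. 0 < g \<and> g \<le> t"
  shows "desc (unconjugate t gs) \<and> length (unconjugate t gs) = t \<and>
    (\<forall>x\<in>set (unconjugate t gs). x \<le> length gs) \<and> conjugate (unconjugate t gs) = gs"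
  using assms
proof (induction t arbitrary: gs)
  case 0
  then show ?case by (cases gs) auto
next
  case (Suc t)
  define hs where "hs = map (\<lambda>g. g - 1) gs"
  have hs: "desc hs"
    using Suc.prems(1) unfolding hs_def sorted_wrt_map
    by (rule sorted_wrt_mono_rel[rotated]) auto
  have gs: "map Suc hs = gs"
    using Suc.prems(2) by (auto simp: hs_def intro!: map_idI)
  define fs where "fs = filter ((<) 0) hs"
  have fs: "desc fs" "length fs \<le> length gs"
    using hs by (auto simp: fs_def sorted_wrt_filter hs_def)
  have "\<forall>g\<in>set fs. 0 < g \<and> g \<le> t"
    using Suc.prems(2) by (auto simp: fs_def hs_def)
  note IH = Suc.IH[OF fs(1) this]
  have "fs @ replicate (length hs - length fs) 0 = hs"
    unfolding fs_def by (rule filter_pos_append_zeros[OF hs])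
  moreover have "length gs = length hs" by (simp add: hs_def)
  ultimately have "conjugate (length gs # unconjugate t fs) = gs"
    using IH gs by simp
  moreover have "unconjugate (Suc t) gs = length gs # unconjugate t fs"
    by (simp add: fs_def hs_def)
  ultimately show ?case using IH fs(2) by auto
qed

section \<open>Durfee squares\<close>

lemma part_antimono: "desc xs \<Longrightarrow> 1 \<le> i \<Longrightarrow> i \<le> j \<Longrightarrow> part xs j \<le> part xs i"
  by (cases "i = j") (auto simp: part_def sorted_wrt_iff_nth_less)

text \<open>By monotonicity it suffices that side \<open>s\<close> fits and side
  \<open>Suc s\<close> does not.\<close>

lemma durfee1_eqI:
  assumes "desc xs" "s \<le> part xs s" "part xs (Suc s) \<le> s"
  shows "durfee1 xs = s"
  unfolding durfee1_def
proof (rule Greatest_equality)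
  fix y assume "y \<le> part xs y"
  then show "y \<le> s"
    using part_antimono[OF assms(1), of "Suc s" y] assms(3) by (cases "y \<le> s") auto
qed (use assms in simp)

lemma durfee2_eqI:
  assumes "desc xs" "t \<le> part xs (durfee1 xs + t)" "part xs (durfee1 xs + Suc t) \<le> t"
  shows "durfee2 xs = t"
  unfolding durfee2_def
proof (rule Greatest_equality)
  fix y assume "y \<le> part xs (durfee1 xs + y)"
  then show "y \<le> t"
    using part_antimono[OF assms(1), of "durfee1 xs + Suc t" "durfee1 xs + y"] assms(3)
    by (cases "y \<le> t") auto
qed (use assms in simp)

text \<open>Supplies the finite bound under which the greatest side length exists.\<close>

lemma le_part_imp_le_length: "y \<le> part xs (i + y) \<Longrightarrow> y \<le> length xs"
  by (auto simp: part_def split: if_splits)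

lemma durfee1_le_part: "durfee1 xs \<le> part xs (durfee1 xs)"
  unfolding durfee1_def
  by (rule GreatestI_nat[where k = 0 and b = "length xs"])
    (use le_part_imp_le_length[of _ xs 0] in auto)

lemma part_Suc_durfee1: "part xs (Suc (durfee1 xs)) \<le> durfee1 xs"
proof (rule ccontr)
  assume "\<not> ?thesis"
  then have "Suc (durfee1 xs) \<le> durfee1 xs"
    using le_part_imp_le_length[of _ xs 0] unfolding durfee1_def
    by (intro Greatest_le_nat[where b = "length xs"]) auto
  then show False by simp
qed

lemma durfee2_le_part: "durfee2 xs \<le> part xs (durfee1 xs + durfee2 xs)"
  unfolding durfee2_def
  by (rule GreatestI_nat[where k = 0 and b = "length xs"])
    (use le_part_imp_le_length in auto)

lemma le_durfee2: "t \<le> part xs (durfee1 xs + t) \<Longrightarrow> t \<le> durfee2 xs"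
  unfolding durfee2_def
  by (rule Greatest_le_nat[where b = "length xs"]) (use le_part_imp_le_length in auto)

lemma part_Suc_durfee2: "part xs (durfee1 xs + Suc (durfee2 xs)) \<le> durfee2 xs"
  using le_durfee2[of "Suc (durfee2 xs)" xs] by fastforce

section \<open>Partitions built from their two Durfee squares and the pieces alpha, beta,
  gamma\<close>

definition assemble :: "nat list \<Rightarrow> nat list \<Rightarrow> nat list \<Rightarrow> nat list" where
  "assemble as bs gs = map ((+) (length as)) as @ map ((+) (length bs)) bs @ gs"

text \<open>The lengths of \<open>as\<close> and \<open>bs\<close> record the sides s and t, with
  zeros as padding. The upper bounds on the parts of beta and gamma keep the first and second square
  maximal.\<close>

definition durfee_data :: "nat list \<Rightarrow> nat list \<Rightarrow> nat list \<Rightarrow> bool" where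
  "durfee_data as bs gs \<longleftrightarrow>
     desc as \<and> desc bs \<and> desc gs \<and> bs \<noteq> [] \<and> length bs \<le> length as \<and>
     (\<forall>b\<in>set bs. b \<le> length as - length bs) \<and> (\<forall>g\<in>set gs. 0 < g \<and> g \<le> length bs)"

lemma sum_list_map_add: "sum_list (map ((+) (c::nat)) xs) = c * length xs + sum_list xs"
  by (induction xs) auto

lemma sum_list_assemble:
  "sum_list (assemble as bs gs) =
    (length as)\<^sup>2 + (length bs)\<^sup>2 + sum_list as + sum_list bs + sum_list gs"
  by (simp add: assemble_def sum_list_map_add power2_eq_square)

lemma desc_assemble:
  assumes "durfee_data as bs gs"
  shows "desc (assemble as bs gs)"
proof -
  have bs: "length bs + b \<le> length as + a" if "b \<in> set bs" for a b
    using assms that by (auto simp: durfee_data_def le_diff_conv2 add.commute trans_le_add1)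
  have gs: "g \<le> length bs + b" "g \<le> length as + a" if "g \<in> set gs" for a b g
    using assms that by (auto simp: durfee_data_def intro: trans_le_add1 order.trans)
  show ?thesis
    using assms by (simp add: assemble_def durfee_data_def sorted_wrt_append sorted_wrt_map
        ball_Un bs gs)
qed

lemma part_assemble_alpha:
  "1 \<le> i \<Longrightarrow> i \<le> length as \<Longrightarrow> part (assemble as bs gs) i = length as + as ! (i - 1)"
  by (auto simp: part_def assemble_def nth_append)

lemma part_assemble_beta:
  "1 \<le> i \<Longrightarrow> i \<le> length bs \<Longrightarrow>
    part (assemble as bs gs) (length as + i) = length bs + bs ! (i - 1)"
  by (auto simp: part_def assemble_def nth_append)

lemma part_assemble_gamma:
  "1 \<le> i \<Longrightarrow> part (assemble as bs gs) (length as + length bs + i) = part gs i"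
  by (auto simp: part_def assemble_def nth_append)

lemma durfee1_assemble:
  assumes "durfee_data as bs gs"
  shows "durfee1 (assemble as bs gs) = length as"
proof (rule durfee1_eqI[OF desc_assemble[OF assms]])
  have "bs \<noteq> []" "length bs \<le> length as" "\<forall>b\<in>set bs. b \<le> length as - length bs"
    using assms by (auto simp: durfee_data_def)
  moreover from this have "bs ! 0 \<le> length as - length bs" by simp
  ultimately have "0 < length bs" "0 < length as" "length bs + bs ! 0 \<le> length as"
    by (auto simp: le_diff_conv2 add.commute)
  then show "length as \<le> part (assemble as bs gs) (length as)"
    "part (assemble as bs gs) (Suc (length as)) \<le> length as"
    using part_assemble_alpha[of "length as" as bs gs] part_assemble_beta[of 1 bs as gs]
    by (simp_all add: Suc_le_eq)
qed

lemma durfee2_assemble: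
  assumes "durfee_data as bs gs"
  shows "durfee2 (assemble as bs gs) = length bs"
proof (rule durfee2_eqI[OF desc_assemble[OF assms]])
  have "bs \<noteq> []" "\<forall>g\<in>set gs. g \<le> length bs"
    using assms by (auto simp: durfee_data_def)
  moreover have "part gs 1 \<le> length bs"
    using calculation(2) by (cases gs) (auto simp: part_def)
  ultimately
  show "length bs \<le> part (assemble as bs gs) (durfee1 (assemble as bs gs) + length bs)"
    "part (assemble as bs gs) (durfee1 (assemble as bs gs) + Suc (length bs)) \<le> length bs"
    using part_assemble_beta[of "length bs" bs as gs] part_assemble_gamma[of 1 as bs gs]
    by (simp_all add: durfee1_assemble[OF assms] Suc_le_eq)
qed

text \<open>The two sides are recovered as Durfee numbers, so both lists are cut at the same
  places.\<close>

lemma assemble_inject: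
  assumes "durfee_data as bs gs" "durfee_data as' bs' gs'"
    "assemble as bs gs = assemble as' bs' gs'"
  shows "as = as' \<and> bs = bs' \<and> gs = gs'"
proof -
  have len: "length as = length as'" "length bs = length bs'"
    using durfee1_assemble[OF assms(1)] durfee1_assemble[OF assms(2)]
      durfee2_assemble[OF assms(1)] durfee2_assemble[OF assms(2)] assms(3) by simp_all
  with assms(3) have "map ((+) (length as')) as = map ((+) (length as')) as'"
    "map ((+) (length bs')) bs = map ((+) (length bs')) bs'" "gs = gs'"
    by (simp_all add: assemble_def)
  then show ?thesis by simp
qed

text \<open>The empty list is excluded by hand, since \<open>rogers_ramanujan\<close> is false for
  it; this is harmless for partitions of \<open>n \<ge> 1\<close>.\<close>

definition nonRR :: "nat list set" where
  "nonRR = {xs. is_partition xs (sum_list xs) \<and> xs \<noteq> [] \<and> \<not> rogers_ramanujan xs}"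

text \<open>The last part is at most s or at most t, according to whether gamma is empty, while
  there are at least s + t parts.\<close>

lemma assemble_nonRR:
  assumes "durfee_data as bs gs"
  shows "assemble as bs gs \<in> nonRR"
proof -
  have pos: "\<forall>x\<in>set (assemble as bs gs). 0 < x"
    using assms by (auto simp: durfee_data_def assemble_def)
  have "last (assemble as bs gs) < length (assemble as bs gs)"
  proof (cases "gs = []")
    case True
    have "last bs \<in> set bs" using assms by (auto simp: durfee_data_def)
    then have "length bs + last bs \<le> length as" "bs \<noteq> []"
      using assms by (auto simp: durfee_data_def le_diff_conv2 add.commute)
    then show ?thesis
      using True by (simp add: assemble_def last_map le_less_trans)
  next
    case False
    then have "last gs \<le> length bs" using assms by (auto simp: durfee_data_def)
    with False show ?thesis by (cases gs) (auto simp: assemble_def)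
  qed
  moreover have "assemble as bs gs \<noteq> []" using assms by (auto simp: durfee_data_def assemble_def)
  ultimately show ?thesis
    using desc_assemble[OF assms] pos by (simp add: nonRR_def is_partition_def rogers_ramanujan_def)
qed

lemma nonRR_assemble:
  assumes "xs \<in> nonRR"
  obtains as bs gs where "durfee_data as bs gs" "xs = assemble as bs gs"
proof -
  define s where "s = durfee1 xs"
  define t where "t = durfee2 xs"
  have desc: "desc xs" and pos: "\<forall>x\<in>set xs. 0 < x" and ne: "xs \<noteq> []"
    and last: "last xs < length xs"
    using assms by (auto simp: nonRR_def is_partition_def rogers_ramanujan_def)
  have s: "s \<le> part xs s" "part xs (Suc s) \<le> s"
    unfolding s_def by (rule durfee1_le_part, rule part_Suc_durfee1)
  have t: "t \<le> part xs (s + t)" "part xs (s + Suc t) \<le> t"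
    unfolding s_def t_def by (rule durfee2_le_part, rule part_Suc_durfee2)
  have s_pos: "0 < s"
  proof (rule ccontr)
    assume "\<not> ?thesis"
    with s(2) have "part xs 1 = 0" by simp
    with ne pos show False by (cases xs) (auto simp: part_def)
  qed
  \<comment> \<open>A first square reaching the last row would force the smallest part to be at
    least the number of parts.\<close>
  have s_less: "s < length xs"
  proof (rule ccontr)
    assume "\<not> ?thesis"
    with s(1) s_pos have "s = length xs" by (auto simp: part_def split: if_splits)
    with s(1) last s_pos show False by (auto simp: part_def last_conv_nth ne)
  qed
  have "1 \<le> part xs (s + 1)" using s_less pos by (auto simp: part_def Suc_le_eq)
  then have t_pos: "0 < t" using le_durfee2[of 1 xs] by (simp add: s_def t_def)
  have st: "s + t \<le> length xs" using t(1) t_pos by (auto simp: part_def split: if_splits)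
  \<comment> \<open>Row s + t has length at least t, and is no longer than row s + 1, which has
    length at most s.\<close>
  have ts: "t \<le> s"
    using t(1) s(2) part_antimono[OF desc, of "Suc s" "s + t"] t_pos by simp
  define as where "as = map (\<lambda>x. x - s) (take s xs)"
  define bs where "bs = map (\<lambda>x. x - t) (take t (drop s xs))"
  define gs where "gs = drop (s + t) xs"
  have len: "length as = s" "length bs = t" using st by (auto simp: as_def bs_def)
  have ge_s: "s \<le> x" if x: "x \<in> set (take s xs)" for x
  proof -
    from x obtain i where "i < s" "x = xs ! i" "i < length xs" by (auto simp: in_set_conv_nth)
    then show ?thesis
      using s(1) part_antimono[OF desc, of "Suc i" s] by (simp add: part_def)
  qed
  have ge_t: "t \<le> x \<and> x \<le> s" if x: "x \<in> set (take t (drop s xs))" for x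
  proof -
    from x obtain i where "i < t" "x = xs ! (s + i)" "s + i < length xs"
      using st by (auto simp: in_set_conv_nth)
    then show ?thesis
      using t(1) s(2) part_antimono[OF desc, of "Suc (s + i)" "s + t"]
        part_antimono[OF desc, of "Suc s" "Suc (s + i)"] by (simp add: part_def)
  qed
  have le_t: "0 < x \<and> x \<le> t" if x: "x \<in> set gs" for x
  proof -
    from x obtain i where "x = xs ! (s + t + i)" "s + t + i < length xs"
      by (auto simp: in_set_conv_nth gs_def)
    then show ?thesis
      using t(2) pos part_antimono[OF desc, of "s + Suc t" "Suc (s + t + i)"]
      by (simp add: part_def)
  qed
  have desc': "desc (map (\<lambda>x. x - c) ys)" if "desc ys" for c ys
    using that unfolding sorted_wrt_map by (rule sorted_wrt_mono_rel[rotated]) auto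
  have "desc as" "desc bs" "desc gs"
    unfolding as_def bs_def gs_def
    using desc by (intro desc' sorted_wrt_take sorted_wrt_drop; assumption)+
  moreover have "bs \<noteq> []" using len t_pos by auto
  moreover have "\<forall>b\<in>set bs. b \<le> s - t"
    using ge_t unfolding bs_def set_map by (blast intro: diff_le_mono)
  ultimately have "durfee_data as bs gs"
    using ts le_t by (simp add: durfee_data_def len)
  moreover have "map ((+) s) as = take s xs"
    unfolding as_def map_map by (rule map_idI) (use ge_s in simp)
  moreover have "map ((+) t) bs = take t (drop s xs)"
    unfolding bs_def map_map
    by (rule map_idI, unfold comp_apply, rule le_add_diff_inverse) (use ge_t in blast)
  moreover have "take s xs @ take t (drop s xs) @ gs = xs"
    unfolding gs_def by (metis append_take_drop_id drop_drop add.commute)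
  ultimately show ?thesis
    by (intro that[of as bs gs]) (simp_all add: assemble_def len)
qed

lemma rank20_assemble:
  assumes "durfee_data as bs gs"
  shows "rank20 (assemble as bs gs) =
    int (hd bs + as ! (length as - length bs - hd bs)) - int (length gs)"
proof -
  let ?xs = "assemble as bs gs"
  have ne: "bs \<noteq> []" "length bs \<le> length as" "\<forall>g\<in>set gs. 0 < g"
    using assms by (auto simp: durfee_data_def)
  have b: "beta_part ?xs 1 = hd bs"
    using ne part_assemble_beta[of 1 bs as gs]
    by (simp add: beta_part_def durfee1_assemble[OF assms] durfee2_assemble[OF assms]
        hd_conv_nth Suc_le_eq)
  \<comment> \<open>This 1-based index stays in the range of alpha because t is positive; it is one
    more than the list index.\<close>
  let ?i = "length as - length bs - hd bs + 1"
  have "0 < length bs" using ne by simp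
  then have "?i \<le> length as" using ne by linarith
  then have a: "alpha_part ?xs ?i = as ! (length as - length bs - hd bs)"
    using part_assemble_alpha[of ?i as bs gs]
    by (simp add: alpha_part_def durfee1_assemble[OF assms])
  have "{i. 1 \<le> i \<and> 1 \<le> gamma_part ?xs i} = {1..length gs}"
    using ne(3) part_assemble_gamma[of _ as bs gs]
    by (auto simp: gamma_part_def durfee1_assemble[OF assms] durfee2_assemble[OF assms]
        part_def Suc_le_eq split: if_splits)
  then have "conj_part (gamma_part ?xs) 1 = length gs"
    by (simp add: conj_part_def)
  with a b show ?thesis
    by (simp add: rank20_def durfee1_assemble[OF assms] durfee2_assemble[OF assms])
qed

section \<open>The involution\<close>

text \<open>Triples (mu, nu, delta); the sides of the Durfee squares are
  \<open>length ms + length ns\<close> and \<open>length ms\<close>.\<close>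
definition codes :: "(nat list \<times> nat list \<times> nat list) set" where
  "codes = {(ms, ns, ds). desc ms \<and> desc ns \<and> desc ds \<and> ms \<noteq> [] \<and> length ds = length ms}"

definition decode :: "nat list \<times> nat list \<times> nat list \<Rightarrow> nat list" where
  "decode = (\<lambda>(ms, ns, ds). assemble (fst (join ms ns)) (snd (join ms ns)) (conjugate ds))"

lemma durfee_data_join:
  assumes "(ms, ns, ds) \<in> codes"
  shows "durfee_data (fst (join ms ns)) (snd (join ms ns)) (conjugate ds)"
proof -
  obtain as bs where j: "join ms ns = (as, bs)" by fastforce
  have "bs \<noteq> []" using length_join(2)[OF j] assms by (auto simp: codes_def)
  then show ?thesis
    using assms desc_join[OF j] length_join[OF j] snd_join_le[OF j]
      desc_conjugate set_conjugate[of _ ds]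
    by (auto simp: codes_def durfee_data_def j)
qed

lemma bij_betw_decode: "bij_betw decode codes nonRR"
proof (rule bij_betw_imageI)
  show "inj_on decode codes"
  proof (rule inj_onI)
    fix c c' assume c: "c \<in> codes" "c' \<in> codes" "decode c = decode c'"
    obtain ms ns ds ms' ns' ds' where eq: "c = (ms, ns, ds)" "c' = (ms', ns', ds')"
      by (metis prod_cases3)
    have "fst (join ms ns) = fst (join ms' ns') \<and> snd (join ms ns) = snd (join ms' ns') \<and>
        conjugate ds = conjugate ds'"
      using c by (intro assemble_inject durfee_data_join) (auto simp: eq decode_def)
    then have j: "join ms ns = join ms' ns'" and d: "conjugate ds = conjugate ds'"
      by (auto intro: prod_eqI)
    have "(ms, ns) = (ms', ns')"
      using unjoin_join[of ms ns] unjoin_join[of ms' ns'] j by (metis prod.collapse)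
    \<comment> \<open>\<open>conjugate\<close> forgets trailing zeros, so delta is determined only
      once its length is known, and that length is the one of mu.\<close>
    moreover from this have "desc ds" "desc ds'" "length ds = length ds'"
      using c(1,2) by (simp_all add: eq codes_def)
    then have "ds = ds'" using d unconjugate_conjugate by metis
    ultimately show "c = c'" by (simp add: eq)
  qed
  show "decode ` codes = nonRR"
  proof safe
    fix ms ns ds assume "(ms, ns, ds) \<in> codes"
    then show "decode (ms, ns, ds) \<in> nonRR"
      by (simp add: decode_def assemble_nonRR durfee_data_join)
  next
    fix xs assume "xs \<in> nonRR"
    then obtain as bs gs where D: "durfee_data as bs gs" "xs = assemble as bs gs"
      by (rule nonRR_assemble)
    obtain ms ns where u: "unjoin as bs = (ms, ns)" by fastforce
    have j: "desc ms \<and> desc ns \<and> join ms ns = (as, bs)"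
      using D(1) by (intro join_unjoin[OF u]) (auto simp: durfee_data_def)
    define ds where "ds = unconjugate (length bs) gs"
    have d: "desc ds" "length ds = length bs" "conjugate ds = gs"
      using conjugate_unconjugate[of gs "length bs"] D(1) by (auto simp: durfee_data_def ds_def)
    have "length ms = length bs" using j length_join(2) by metis
    moreover have "bs \<noteq> []" using D(1) by (simp add: durfee_data_def)
    ultimately have "(ms, ns, ds) \<in> codes" using j d by (auto simp: codes_def)
    moreover have "decode (ms, ns, ds) = xs" using j d D(2) by (simp add: decode_def)
    ultimately show "xs \<in> decode ` codes" by (metis imageI)
  qed
qed

lemma sum_list_decode:
  assumes "(ms, ns, ds) \<in> codes"
  shows "sum_list (decode (ms, ns, ds)) =
    (length ms + length ns)\<^sup>2 + (length ms)\<^sup>2 + sum_list ms + sum_list ns + sum_list ds"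
proof -
  obtain as bs where j: "join ms ns = (as, bs)" by fastforce
  then show ?thesis
    using length_join[OF j] sum_list_join[OF j] sum_list_conjugate[of ds] assms
    by (simp add: decode_def sum_list_assemble codes_def)
qed

text \<open>By \<open>hd_join\<close> the first two terms of the rank add up to the first part of
  mu, and the number of parts of gamma is the first part of delta.\<close>

lemma rank20_decode:
  assumes "(ms, ns, ds) \<in> codes"
  shows "rank20 (decode (ms, ns, ds)) = int (hd ms) - int (hd ds)"
proof -
  obtain as bs where j: "join ms ns = (as, bs)" by fastforce
  have "ms \<noteq> []" "desc ds" "ds \<noteq> []" using assms by (auto simp: codes_def)
  then show ?thesis
    using hd_join[OF j] length_join[OF j] length_conjugate[of ds]
      rank20_assemble[OF durfee_data_join[OF assms]]
    by (simp add: decode_def j)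
qed

section \<open>Counting by size and rank, and the exchange of mu and delta\<close>

definition rank_codes :: "nat \<Rightarrow> int \<Rightarrow> (nat list \<times> nat list \<times> nat list) set" where
  "rank_codes n r = {c \<in> codes. sum_list (decode c) = n \<and> rank20 (decode c) = r}"

lemma h0_eq_card_rank_codes:
  assumes "1 \<le> n"
  shows "h0 n r = card (rank_codes n r)"
proof -
  have "{xs. is_partition xs n \<and> \<not> rogers_ramanujan xs \<and> rank20 xs = r} =
      {xs \<in> nonRR. sum_list xs = n \<and> rank20 xs = r}"
    using assms by (auto simp: nonRR_def is_partition_def)
  also have "\<dots> = decode ` rank_codes n r"
    using bij_betw_decode by (auto simp: rank_codes_def bij_betw_def)
  also have "card \<dots> = card (rank_codes n r)"
    using bij_betw_decode
    by (intro card_image) (auto simp: rank_codes_def bij_betw_def elim: inj_on_subset)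
  finally show ?thesis by (simp add: h0_def)
qed

text \<open>Mu and delta have equal length, so the exchange keeps both squares; the size formula is
  symmetric in the two and the rank antisymmetric.\<close>

lemma swap_in_rank_codes:
  assumes "(ms, ns, ds) \<in> rank_codes n r"
  shows "(ds, ns, ms) \<in> rank_codes n (- r)"
proof -
  have c: "(ms, ns, ds) \<in> codes" and c': "(ds, ns, ms) \<in> codes"
    using assms by (auto simp: rank_codes_def codes_def)
  have "length ds = length ms" using c by (simp add: codes_def)
  with assms c' show ?thesis
    by (auto simp: rank_codes_def sum_list_decode[OF c] sum_list_decode[OF c']
        rank20_decode[OF c] rank20_decode[OF c'])
qed

theorem mainTheorem2:
  fixes n :: nat and r :: int
  assumes "n \<ge> 1"
  shows "h0 n r = h0 n (- r)"
proof -
  let ?swap = "\<lambda>(ms, ns, ds). (ds, ns, ms)"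
  have "bij_betw ?swap (rank_codes n r) (rank_codes n (- r))"
    \<comment> \<open>The exchange is its own inverse, and the instance at \<open>- r\<close> leads
      back to \<open>r\<close>.\<close>
    using swap_in_rank_codes[of _ _ _ n r] swap_in_rank_codes[of _ _ _ n "- r"]
    by (intro bij_betw_byWitness[where f' = ?swap]) auto
  then show ?thesis
    using assms by (simp add: h0_eq_card_rank_codes bij_betw_same_card)
qed

end
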